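(* Let $x:\mathbb{Z}_+\to\mathbb{R}^n$ be any discrete-time signal, $k\in\mathbb{Z}_+$ any time step, and $\varphi$ any finite-time STL specification (with $\mathcal{C}^1$-smooth predicate functions). Let the parameters of the D-GMSR robustness measure $\Gamma^{\varphi}_{\bm{\epsilon},\bm{p},\bm{w}}$ be arbitrary, with every $\epsilon_i\in\mathbb{R}_{++}$, every $p_i\in\mathbb{Z}_{++}$, and every $w_i\in\mathbb{Z}_{++}^{n_i}$ (where $n_i$ is the number of arguments of the corresponding key function). Then $$(x,k)\models\varphi\iff \Gamma^{\varphi}_{\bm{\epsilon},\bm{p},\bm{w}}(x,k)\ge 0,$$ where satisfaction $(x,k)\models\varphi$ means that the (min/max) space robustness satisfies $\rho^{\varphi}(x,k)\ge 0$.
   Context: Notation. $\mathbb{Z}_+$ and $\mathbb{Z}_{++}$ are the non-negative and positive integers, $\mathbb{R}_+$ and $\mathbb{R}_{++}$ the non-negative and positive reals; $[a{:}b]$ is the set of integers $k$ with $a\le k\le b$ ($a,b\in\mathbb{Z}_+$, $a\le b$); $\bm{1}$ is the all-ones vector. For a signal $x$, $x_k$ denotes its value at time $k$. For $y\in\mathbb{R}^m$, $|y|_+^2:=(\max(y_1,0)^2,\dots,\max(y_m,0)^2)$ and $|y|_-^2:=(\min(y_1,0)^2,\dots,\min(y_m,0)^2)$; $\min(y)$, $\max(y)$ are the smallest and largest entries of $y$. STL formulas. A predicate is $\mu=(f(x)\ge 0)$ with $f:\mathbb{R}^n\to\mathbb{R}$ its ($\mathcal{C}^1$) predicate function. Finite-time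 STL specifications are built recursively from finitely many predicates by $\neg\varphi$, $\varphi_1\wedge\varphi_2$, $\varphi_1\vee\varphi_2$, $\varphi_1\Rightarrow\varphi_2$, and the temporal operators eventually $\bm{F}_{[a:b]}\varphi$, always $\bm{G}_{[a:b]}\varphi$, until $\varphi_1\bm{U}_{[a:b]}\varphi_2$ over bounded non-empty intervals $[a{:}b]$. Space robustness (D-SR) and satisfaction. The space robustness $\rho^{\varphi}(x,k)$ is defined recursively by - $\rho^{\mu}(x,k):=f(x_k)$; $\rho^{\neg\varphi}(x,k):=-\rho^{\varphi}(x,k)$; - $\rho^{\varphi_1\wedge\varphi_2}(x,k):=\min(\rho^{\varphi_1}(x,k),\rho^{\varphi_2}(x,k))$; $\rho^{\varphi_1\vee\varphi_2}(x,k):=\max(\rho^{\varphi_1}(x,k),\rho^{\varphi_2}(x,k))$; $\rho^{\varphi_1\Rightarrow\varphi_2}(x,k):=\max(-\rho^{\varphi_1}(x,k),\rho^{\varphi_2}(x,k))$; - $\rho^{\bm{F}_{[a:b]}\varphi}(x,k):=\max_{j\in[a:b]}\rho^{\varphi}(x,k+j)$; $\rho^{\bm{G}_{[a:b]}\varphi}(x,k):=\min_{j\in[a:b]}\rho^{\varphi}(x,k+j)$; - $\rho^{\varphi_1\bm{U}_{[a:b]}\varphi_2}(x,k):=\max_{j\in[a:b]}\min\big(\rho^{\bm{G}_{[a:j]}\varphi_1}(x,k),\rho^{\varphi_2}(x,k+j)\big)$. Satisfaction is identified with non-negative space robustness: $(x,k)\models\varphi\iff\rho^{\varphi}(x,k)\ge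 0$. Key functions. For $m\in\mathbb{Z}_{++}$, $\epsilon\in\mathbb{R}_{++}$, $p\in\mathbb{Z}_{++}$, $w\in\mathbb{Z}_{++}^m$, and $z\in\mathbb{R}_+^m$, let $$M_{0,w}^{\epsilon}(z):=\Big(\epsilon^{\bm{1}^Tw}+\prod_{i=1}^m z_i^{w_i}\Big)^{1/\bm{1}^Tw},\qquad M_{p,w}^{\epsilon}(z):=\Big(\epsilon^p+\frac{1}{\bm{1}^Tw}\sum_{i=1}^m w_i z_i^p\Big)^{1/p},$$ and for $y\in\mathbb{R}^m$, $${}^{\wedge}h_{p,w}^{\epsilon}(y):=\big(M_{0,w}^{\epsilon}(|y|_+^2)\big)^{1/2}-\big(M_{p,w}^{\epsilon}(|y|_-^2)\big)^{1/2},\qquad {}^{\vee}h_{p,w}^{\epsilon}(y):=-{}^{\wedge}h_{p,w}^{\epsilon}(-y).$$ D-GMSR. $\Gamma^{\varphi}=\Gamma^{\varphi}_{\bm{\epsilon},\bm{p},\bm{w}}$ is defined recursively as follows, where $\bm{\epsilon},\bm{p},\bm{w}$ collect the parameters $\epsilon_i\in\mathbb{R}_{++}$, $p_i\in\mathbb{Z}_{++}$, $w_i$ (positive integer vectors of the appropriate length) used by the key functions occurring in the construction; each operator occurrence may have its own parameters, which do not depend on $x$ or $k$ (the parameters are suppressed from the key functions below): - $\Gamma^{\mu}(x,k):=f(x_k)$; $\Gamma^{\neg\varphi}(x,k):=-\Gamma^{\varphi}(x,k)$; - $\Gamma^{\varphi_1\wedge\varphi_2}(x,k):={}^{\wedge}h(\Gamma^{\varphi_1}(x,k),\Gamma^{\varphi_2}(x,k))$;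 - $\Gamma^{\varphi_1\vee\varphi_2}(x,k):={}^{\vee}h(\Gamma^{\varphi_1}(x,k),\Gamma^{\varphi_2}(x,k))$; - $\Gamma^{\varphi_1\Rightarrow\varphi_2}(x,k):={}^{\vee}h(-\Gamma^{\varphi_1}(x,k),\Gamma^{\varphi_2}(x,k))$; - $\Gamma^{\bm{F}_{[a:b]}\varphi}(x,k):={}^{\vee}h(\Gamma^{\varphi}(x,k+a),\Gamma^{\varphi}(x,k+a+1),\dots,\Gamma^{\varphi}(x,k+b))$; - $\Gamma^{\bm{G}_{[a:b]}\varphi}(x,k):={}^{\wedge}h(\Gamma^{\varphi}(x,k+a),\Gamma^{\varphi}(x,k+a+1),\dots,\Gamma^{\varphi}(x,k+b))$; - $\Gamma^{\varphi_1\bm{U}_{[a:b]}\varphi_2}(x,k):={}^{\vee}h(\eta_a,\eta_{a+1},\dots,\eta_b)$, where $\eta_j:={}^{\wedge}h(\Gamma^{\bm{G}_{[a:j]}\varphi_1}(x,k),\Gamma^{\varphi_2}(x,k+j))$ for $j\in[a{:}b]$. *)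

theory Defs
  imports "HOL-Analysis.Analysis"
begin

datatype 's stl =
    Pred "'s \<Rightarrow> real"
  | Neg "'s stl"
  | Conj "'s stl" "'s stl"
  | Disj "'s stl" "'s stl"
  | Implies "'s stl" "'s stl"
  | Eventually nat nat "'s stl"
  | Always nat nat "'s stl"
  | Until nat nat "'s stl" "'s stl"

definition C1 :: "('s::real_normed_vector \<Rightarrow> real) \<Rightarrow> bool" where
  "C1 f \<longleftrightarrow> (\<exists>f' :: 's \<Rightarrow> 's \<Rightarrow>\<^sub>L real.
     (\<forall>v. (f has_derivative blinfun_apply (f' v)) (at v)) \<and> continuous_on UNIV f')"

primrec stl_spec :: "'s::real_normed_vector stl \<Rightarrow> bool" where
  "stl_spec (Pred f) \<longleftrightarrow> C1 f"
| "stl_spec (Neg \<phi>) \<longleftrightarrow> stl_spec \<phi>"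
| "stl_spec (Conj \<phi> \<psi>) \<longleftrightarrow> stl_spec \<phi> \<and> stl_spec \<psi>"
| "stl_spec (Disj \<phi> \<psi>) \<longleftrightarrow> stl_spec \<phi> \<and> stl_spec \<psi>"
| "stl_spec (Implies \<phi> \<psi>) \<longleftrightarrow> stl_spec \<phi> \<and> stl_spec \<psi>"
| "stl_spec (Eventually a b \<phi>) \<longleftrightarrow> a \<le> b \<and> stl_spec \<phi>"
| "stl_spec (Always a b \<phi>) \<longleftrightarrow> a \<le> b \<and> stl_spec \<phi>"
| "stl_spec (Until a b \<phi> \<psi>) \<longleftrightarrow> a \<le> b \<and> stl_spec \<phi> \<and> stl_spec \<psi>"

text \<open>In the until case, the inner minimum is the space robustness of
  \<open>Always a j \<phi>\<close> written out, which keeps the recursion primitive.\<close>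

primrec space_robustness :: "'s stl \<Rightarrow> (nat \<Rightarrow> 's) \<Rightarrow> nat \<Rightarrow> real" where
  "space_robustness (Pred f) x k = f (x k)"
| "space_robustness (Neg \<phi>) x k = - space_robustness \<phi> x k"
| "space_robustness (Conj \<phi> \<psi>) x k =
     min (space_robustness \<phi> x k) (space_robustness \<psi> x k)"
| "space_robustness (Disj \<phi> \<psi>) x k =
     max (space_robustness \<phi> x k) (space_robustness \<psi> x k)"
| "space_robustness (Implies \<phi> \<psi>) x k =
     max (- space_robustness \<phi> x k) (space_robustness \<psi> x k)"
| "space_robustness (Eventually a b \<phi>) x k =
     (MAX j\<in>{a..b}. space_robustness \<phi> x (k + j))"
| "space_robustness (Always a b \<phi>) x k =
     (MIN j\<in>{a..b}. space_robustness \<phi> x (k + j))"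
| "space_robustness (Until a b \<phi> \<psi>) x k =
     (MAX j\<in>{a..b}. min (MIN i\<in>{a..j}. space_robustness \<phi> x (k + i))
                        (space_robustness \<psi> x (k + j)))"

definition satisfies :: "(nat \<Rightarrow> 's) \<Rightarrow> nat \<Rightarrow> 's stl \<Rightarrow> bool" where
  "satisfies x k \<phi> \<longleftrightarrow> space_robustness \<phi> x k \<ge> 0"

text \<open>Vectors of variable length \<open>m\<close> are lists. The weights of a key function with
  \<open>m\<close> arguments are a list of length \<open>m\<close> (enforced by \<open>valid_key\<close> below).\<close>

datatype key_params = Key_Params (eps: real) (pow: nat) (wts: "nat list")

definition valid_key :: "nat \<Rightarrow> key_params \<Rightarrow> bool" where
  "valid_key m K \<longleftrightarrow>
     eps K > 0 \<and> pow K > 0 \<and> length (wts K) = m \<and> (\<forall>w\<in>set (wts K). w > 0)"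

definition M0 :: "real \<Rightarrow> nat list \<Rightarrow> real list \<Rightarrow> real" where
  "M0 e w z = (e ^ sum_list w + (\<Prod>i<length z. z ! i ^ (w ! i))) powr (1 / real (sum_list w))"

definition Mp :: "real \<Rightarrow> nat \<Rightarrow> nat list \<Rightarrow> real list \<Rightarrow> real" where
  "Mp e p w z =
     (e ^ p + 1 / real (sum_list w) * (\<Sum>i<length z. real (w ! i) * z ! i ^ p)) powr (1 / real p)"

definition and_h :: "key_params \<Rightarrow> real list \<Rightarrow> real" where
  "and_h K y = sqrt (M0 (eps K) (wts K) (map (\<lambda>t. (max t 0)\<^sup>2) y))
             - sqrt (Mp (eps K) (pow K) (wts K) (map (\<lambda>t. (min t 0)\<^sup>2) y))"

definition or_h :: "key_params \<Rightarrow> real list \<Rightarrow> real" where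
  "or_h K y = - and_h K (map uminus y)"

text \<open>A parameter assignment gives parameters to every key function of every operator
  occurrence. An occurrence is addressed by its path from the root of the formula
  (\<open>0\<close> for the only or first operand, \<open>1\<close> for the second). Every operator but negation
  has its key function at slot \<open>Main\<close>; an until over \<open>[a:b]\<close> has in addition, for each
  \<open>j\<close> in \<open>[a:b]\<close>, the key function of the always over \<open>[a:j]\<close> at \<open>Alw j\<close> and that of
  the conjunction forming the \<open>j\<close>-th argument at \<open>Cnj j\<close>.\<close>

datatype slot = Main | Alw nat | Cnj nat

type_synonym param_assignment = "nat list \<Rightarrow> slot \<Rightarrow> key_params"

definition sub :: "nat \<Rightarrow> param_assignment \<Rightarrow> param_assignment" where
  "sub i P = (\<lambda>path. P (i # path))"

primrec valid_params :: "'s stl \<Rightarrow> param_assignment \<Rightarrow> bool" where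
  "valid_params (Pred f) P \<longleftrightarrow> True"
| "valid_params (Neg \<phi>) P \<longleftrightarrow> valid_params \<phi> (sub 0 P)"
| "valid_params (Conj \<phi> \<psi>) P \<longleftrightarrow>
     valid_key 2 (P [] Main) \<and> valid_params \<phi> (sub 0 P) \<and> valid_params \<psi> (sub 1 P)"
| "valid_params (Disj \<phi> \<psi>) P \<longleftrightarrow>
     valid_key 2 (P [] Main) \<and> valid_params \<phi> (sub 0 P) \<and> valid_params \<psi> (sub 1 P)"
| "valid_params (Implies \<phi> \<psi>) P \<longleftrightarrow>
     valid_key 2 (P [] Main) \<and> valid_params \<phi> (sub 0 P) \<and> valid_params \<psi> (sub 1 P)"
| "valid_params (Eventually a b \<phi>) P \<longleftrightarrow>
     valid_key (b - a + 1) (P [] Main) \<and> valid_params \<phi> (sub 0 P)"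
| "valid_params (Always a b \<phi>) P \<longleftrightarrow>
     valid_key (b - a + 1) (P [] Main) \<and> valid_params \<phi> (sub 0 P)"
| "valid_params (Until a b \<phi> \<psi>) P \<longleftrightarrow>
     valid_key (b - a + 1) (P [] Main) \<and>
     (\<forall>j\<in>{a..b}. valid_key (j - a + 1) (P [] (Alw j)) \<and> valid_key 2 (P [] (Cnj j))) \<and>
     valid_params \<phi> (sub 0 P) \<and> valid_params \<psi> (sub 1 P)"

primrec gmsr :: "'s stl \<Rightarrow> param_assignment \<Rightarrow> (nat \<Rightarrow> 's) \<Rightarrow> nat \<Rightarrow> real" where
  "gmsr (Pred f) P x k = f (x k)"
| "gmsr (Neg \<phi>) P x k = - gmsr \<phi> (sub 0 P) x k"
| "gmsr (Conj \<phi> \<psi>) P x k =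
     and_h (P [] Main) [gmsr \<phi> (sub 0 P) x k, gmsr \<psi> (sub 1 P) x k]"
| "gmsr (Disj \<phi> \<psi>) P x k =
     or_h (P [] Main) [gmsr \<phi> (sub 0 P) x k, gmsr \<psi> (sub 1 P) x k]"
| "gmsr (Implies \<phi> \<psi>) P x k =
     or_h (P [] Main) [- gmsr \<phi> (sub 0 P) x k, gmsr \<psi> (sub 1 P) x k]"
| "gmsr (Eventually a b \<phi>) P x k =
     or_h (P [] Main) (map (\<lambda>j. gmsr \<phi> (sub 0 P) x (k + j)) [a..<Suc b])"
| "gmsr (Always a b \<phi>) P x k =
     and_h (P [] Main) (map (\<lambda>j. gmsr \<phi> (sub 0 P) x (k + j)) [a..<Suc b])"
| "gmsr (Until a b \<phi> \<psi>) P x k =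
     or_h (P [] Main)
       (map (\<lambda>j. and_h (P [] (Cnj j))
               [and_h (P [] (Alw j)) (map (\<lambda>i. gmsr \<phi> (sub 0 P) x (k + i)) [a..<Suc j]),
                gmsr \<psi> (sub 1 P) x (k + j)])
          [a..<Suc b])"

end

theory Submission imports Defs
begin

text \<open>A key function \<open>\<^sup>\<and>h\<close> has exactly the sign of the minimum of its arguments: if all are
  positive, the \<open>M\<^sub>0\<close> term exceeds its floor while the \<open>M\<^sub>p\<close> term equals it; if one is negative,
  the roles are exchanged; otherwise the two floors cancel. Dually for \<open>\<^sup>\<or>h\<close> and the maximum.
  Negation forces the induction to carry the sign of the robustness in \<open>{-1, 0, 1}\<close> rather than
  just its non-negativity; since \<open>sgn\<close> is monotone it commutes with \<open>Min\<close> and \<open>Max\<close>.\<close>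

lemma sgn_of_nonneg: "t \<ge> 0 \<Longrightarrow> sgn t = (if t = 0 then 0 else 1)" for t :: real
  by (simp add: sgn_if)

text \<open>The \<open>n\<close>-th root is strictly increasing and sends \<open>e ^ n\<close> to
  \<open>e\<close>. Both \<open>M0\<close> (with \<open>n\<close> the total weight) and
  \<open>Mp\<close> (with \<open>n = p\<close>) have this shape, so only the sign of the added term
  \<open>t\<close> matters.\<close>

lemma sgn_powr_inverse_diff:
  fixes e t :: real
  assumes "e > 0" "n > 0" "t \<ge> 0"
  shows "sgn ((e ^ n + t) powr (1 / real n) - e) = sgn t"
proof -
  have "e ^ n + t > 0"
    using assms by (simp add: add_pos_nonneg)
  then have eq: "(e ^ n + t) powr (1 / real n) = root n (e ^ n + t)"
    using assms by (simp add: root_powr_inverse)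
  have e: "e = root n (e ^ n)"
    using assms by (simp add: real_root_power_cancel)
  show ?thesis
  proof (cases "t = 0")
    case True
    then show ?thesis using eq e by simp
  next
    case False
    then have "root n (e ^ n) < root n (e ^ n + t)"
      using assms by simp
    then show ?thesis using eq e False assms by simp
  qed
qed

text \<open>A product of powers with positive exponents vanishes as soon as one base does; a zero
  exponent would break this, since \<open>0 ^ 0 = 1\<close>.\<close>

lemma sgn_M0_diff:
  assumes "e > 0" "sum_list w > 0" "\<forall>i<length z. w ! i > 0 \<and> z ! i \<ge> 0"
  shows "sgn (M0 e w z - e) = (if \<exists>i<length z. z ! i = 0 then 0 else 1)"
proof -
  have "(\<Prod>i<length z. z ! i ^ (w ! i)) \<ge> 0"
    using assms by (intro prod_nonneg) auto
  moreover have "(\<Prod>i<length z. z ! i ^ (w ! i)) = 0 \<longleftrightarrow> (\<exists>i<length z. z ! i = 0)"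
    using assms by auto
  ultimately show ?thesis
    unfolding M0_def using assms by (subst sgn_powr_inverse_diff) (auto simp: sgn_if)
qed

text \<open>Dual to the product: a sum of non-negative terms with positive weights vanishes only if
  every \<open>z ! i\<close> does.\<close>

lemma sgn_Mp_diff:
  assumes "e > 0" "p > 0" "sum_list w > 0" "\<forall>i<length z. w ! i > 0 \<and> z ! i \<ge> 0"
  shows "sgn (Mp e p w z - e) = (if \<forall>i<length z. z ! i = 0 then 0 else 1)"
proof -
  let ?S = "\<Sum>i<length z. real (w ! i) * z ! i ^ p"
  have nonneg: "?S \<ge> 0"
    using assms by (intro sum_nonneg) auto
  have zero: "?S = 0 \<longleftrightarrow> (\<forall>i<length z. z ! i = 0)"
    using assms by (subst sum_nonneg_eq_0_iff) (auto, metis lessThan_iff less_irrefl)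
  have "sgn ?S = (if \<forall>i<length z. z ! i = 0 then 0 else 1)"
    using nonneg unfolding zero[symmetric] by (rule sgn_of_nonneg)
  moreover have "sgn (1 / real (sum_list w)) = 1"
    using \<open>sum_list w > 0\<close> by (simp only: sgn_1_pos) simp
  ultimately have "sgn (1 / real (sum_list w) * ?S) = (if \<forall>i<length z. z ! i = 0 then 0 else 1)"
    by (simp only: sgn_mult mult_1)
  moreover have "1 / real (sum_list w) * ?S \<ge> 0"
    using nonneg by simp
  ultimately show ?thesis
    unfolding Mp_def using assms by (subst sgn_powr_inverse_diff) auto
qed

lemma sgn_and_h:
  assumes K: "valid_key (length y) K" and "y \<noteq> []"
  shows "sgn (and_h K y) = Min (sgn ` set y)"
proof -
  let ?A = "M0 (eps K) (wts K) (map (\<lambda>t. (max t 0)\<^sup>2) y)"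
  let ?B = "Mp (eps K) (pow K) (wts K) (map (\<lambda>t. (min t 0)\<^sup>2) y)"
  have len: "length (wts K) = length y" and pos: "\<forall>w\<in>set (wts K). w > 0"
    using K by (auto simp: valid_key_def)
  have w: "\<forall>i<length y. wts K ! i > 0"
    using len pos by auto
  \<comment> \<open>Since \<open>y\<close> is non-empty there is a positive weight, so the total
    weight, the root order in \<open>M0\<close> and the divisor in \<open>Mp\<close>, is
    positive.\<close>
  have "hd (wts K) \<in> set (wts K)"
    using len \<open>y \<noteq> []\<close> by (metis hd_in_set length_0_conv)
  then have s: "sum_list (wts K) > 0"
    using pos member_le_sum_list[of "hd (wts K)" "wts K"] by fastforce
  \<comment> \<open>The entry \<open>(max t 0)\<^sup>2\<close> is zero exactly when
    \<open>t \<le> 0\<close>.\<close>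
  have A: "sgn (?A - eps K) = (if \<exists>t\<in>set y. t \<le> 0 then 0 else 1)"
    using K w s by (subst sgn_M0_diff) (auto simp: valid_key_def Bex_def in_set_conv_nth max_def split: if_splits)
  have "min t 0 = 0 \<longleftrightarrow> t \<ge> 0" for t :: real
    by auto
  then have B: "sgn (?B - eps K) = (if \<forall>t\<in>set y. t \<ge> 0 then 0 else 1)"
    using K w s by (subst sgn_Mp_diff) (auto simp: valid_key_def all_set_conv_all_nth)
  \<comment> \<open>The three cases are those in which the minimum of the signs is 1, 0 and
    -1.\<close>
  consider (p) "\<forall>t\<in>set y. t > 0" | (z) "\<forall>t\<in>set y. t \<ge> 0" "0 \<in> set y"
    | (n) t where "t \<in> set y" "t < 0"
    by (metis less_le_not_le linorder_not_less order_antisym_conv)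
  then show ?thesis
  proof cases
    case p
    then have "?A > eps K" "?B = eps K"
      using A B by (auto simp: sgn_if split: if_splits)
    moreover have "sgn ` set y = {1}"
      using p \<open>y \<noteq> []\<close> by (auto simp: image_iff) (metis hd_in_set sgn_pos)
    ultimately show ?thesis
      by (simp add: and_h_def)
  next
    case z
    then have "?A = eps K" "?B = eps K"
      using A B by (auto simp: sgn_if split: if_splits)
    moreover have "Min (sgn ` set y) = 0"
      using z by (intro Min_eqI) (auto simp: image_iff sgn_if intro!: bexI[of _ 0])
    ultimately show ?thesis
      by (simp add: and_h_def)
  next
    case n
    then have "?A = eps K" "?B > eps K"
      using A B by (auto simp: sgn_if split: if_splits)
    moreover have "Min (sgn ` set y) = -1"
      using n by (intro Min_eqI) (auto simp: image_iff sgn_if intro!: bexI[of _ t])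
    ultimately show ?thesis
      by (simp add: and_h_def)
  qed
qed

text \<open>Negating all entries turns the minimum of the signs into minus their maximum.\<close>

lemma sgn_or_h:
  assumes "valid_key (length y) K" "y \<noteq> []"
  shows "sgn (or_h K y) = Max (sgn ` set y)"
proof -
  have "sgn (or_h K y) = - Min (sgn ` uminus ` set y)"
    using assms by (simp add: or_h_def sgn_minus sgn_and_h)
  also have "sgn ` uminus ` set y = uminus ` sgn ` set y"
    by (simp add: image_image sgn_minus)
  also have "- Min (uminus ` sgn ` set y) = Max (sgn ` set y)"
    using assms by (subst minus_Max_eq_Min[symmetric]) (auto simp: image_image)
  finally show ?thesis .
qed

lemma mono_sgn: "mono (sgn :: real \<Rightarrow> real)"
  by (auto simp: mono_def sgn_if)

lemma sgn_Min: "finite A \<Longrightarrow> A \<noteq> {} \<Longrightarrow> sgn (Min A) = Min (sgn ` A)" for A :: "real set"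
  by (rule mono_Min_commute[OF mono_sgn])

lemma sgn_Max: "finite A \<Longrightarrow> A \<noteq> {} \<Longrightarrow> sgn (Max A) = Max (sgn ` A)" for A :: "real set"
  by (rule mono_Max_commute[OF mono_sgn])

lemma sgn_min: "sgn (min a b) = min (sgn a) (sgn b)" for a b :: real
  by (rule min_of_mono[OF mono_sgn, symmetric])

lemma sgn_max: "sgn (max a b) = max (sgn a) (sgn b)" for a b :: real
  by (rule max_of_mono[OF mono_sgn, symmetric])

lemma sgn_and_h_pair:
  "valid_key 2 K \<Longrightarrow> sgn (and_h K [a, b]) = min (sgn a) (sgn b)"
  by (simp add: sgn_and_h numeral_2_eq_2)

lemma sgn_or_h_pair:
  "valid_key 2 K \<Longrightarrow> sgn (or_h K [a, b]) = max (sgn a) (sgn b)"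
  by (simp add: sgn_or_h numeral_2_eq_2)

text \<open>For \<open>a \<le> b\<close> the list \<open>[a..<Suc b]\<close> is non-empty and its
  length is the number of weights, \<open>b - a + 1\<close>.\<close>

lemma sgn_and_h_upt:
  assumes "valid_key (b - a + 1) K" "a \<le> b"
  shows "sgn (and_h K (map f [a..<Suc b])) = (MIN j\<in>{a..b}. sgn (f j))"
  using assms
  by (subst sgn_and_h) (auto simp: Suc_diff_le image_image atLeastLessThanSuc_atLeastAtMost
      simp del: upt_Suc)

lemma sgn_or_h_upt:
  assumes "valid_key (b - a + 1) K" "a \<le> b"
  shows "sgn (or_h K (map f [a..<Suc b])) = (MAX j\<in>{a..b}. sgn (f j))"
  using assms
  by (subst sgn_or_h) (auto simp: Suc_diff_le image_image atLeastLessThanSuc_atLeastAtMost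
      simp del: upt_Suc)

text \<open>\<open>P\<close> and \<open>k\<close> are generalised because operands are evaluated
  with the parameters \<open>sub i P\<close> and at shifted times.\<close>

lemma sgn_gmsr:
  "stl_spec \<phi> \<Longrightarrow> valid_params \<phi> P \<Longrightarrow> sgn (gmsr \<phi> P x k) = sgn (space_robustness \<phi> x k)"
proof (induction \<phi> arbitrary: P k)
  case (Until a b \<phi> \<psi>)
  \<comment> \<open>Both robustness measures are reduced to this expression in signs: here from the
    key functions and the induction hypotheses, below by moving \<open>sgn\<close> inwards through
    \<open>Max\<close>, \<open>min\<close> and \<open>Min\<close>. Each inner range
    \<open>{a..j}\<close> is non-empty because \<open>a \<le> j\<close>.\<close>
  have "sgn (gmsr (Until a b \<phi> \<psi>) P x k) =
    (MAX j\<in>{a..b}. min (MIN i\<in>{a..j}. sgn (space_robustness \<phi> x (k + i)))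
                       (sgn (space_robustness \<psi> x (k + j))))"
    using Until by (simp add: sgn_or_h_upt sgn_and_h_upt sgn_and_h_pair del: upt_Suc)
  also have "\<dots> = sgn (space_robustness (Until a b \<phi> \<psi>) x k)"
    using Until.prems by (simp add: sgn_Max sgn_Min sgn_min image_image)
  finally show ?case .
qed (simp_all add: sgn_and_h_pair sgn_or_h_pair sgn_and_h_upt sgn_or_h_upt sgn_minus
    sgn_min sgn_max sgn_Min sgn_Max image_image del: upt_Suc)

theorem lemma2:
  fixes x :: "nat \<Rightarrow> real ^ 'n"
    and k :: nat
    and \<phi> :: "(real ^ 'n) stl"
    and P :: param_assignment
  assumes "stl_spec \<phi>"
    and "valid_params \<phi> P"
  shows "satisfies x k \<phi> \<longleftrightarrow> gmsr \<phi> P x k \<ge> 0"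
  using sgn_gmsr[OF assms, of x k] unfolding satisfies_def
  by (metis zero_le_sgn_iff)

end
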